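(* Let $m,n,p$ be positive integers with $p\ge2$, and let $\omega=e^{2\pi\sqrt{-1}/p}$. Suppose that $\mathcal{S}\in F(m,n,p)$ satisfies the third mode symmetry property: $\mathcal{S}(i,i,k)=\mathcal{S}(i,i,p-k+2)$ for $i=1,\dots,\min\{m,n\}$ and $k=2,3,\dots,1+\lfloor\frac{p-1}{2}\rfloor$. Then $\Delta(\mathcal{S})$ is real and diagonal; in particular, for $i=1,\dots,\min\{m,n\}$ and $k=1,\dots,p$, $$\sum_{l=1}^p\omega^{(l-1)(k-1)}\mathcal{S}(i,i,l)=\Delta^{(k)}_{ii}(\mathcal{S})\in\mathbb{R}.$$ Moreover, $\mathcal{S}\in S(m,n,p)$ if and only if for all $i=1,\dots,\min\{m,n\}$ and $k=1,\dots,p$ we have $$\sum_{l=1}^p\omega^{(l-1)(k-1)}\mathcal{S}(i,i,l)\ge0$$ and $$\sum_{l=1}^p\omega^{(l-1)(k-1)}\left[\mathcal{S}(i,i,l)-\mathcal{S}(i+1,i+1,l)\right]\ge0,$$ where $\mathcal{S}(i+1,i+1,l)$ is interpreted as $0$ for $i=\min\{m,n\}$.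
   Context: Let $T(m,n,p)$ be the real linear space of $m\times n\times p$ real tensors; $\mathcal{A}(i,j,k)$ denotes the entries of $\mathcal{A}\in T(m,n,p)$ and $A^{(k)}=\mathcal{A}(:,:,k)\in\mathbb{R}^{m\times n}$ its frontal slices, $k=1,\dots,p$. A tensor is f-diagonal if all its frontal slices are (rectangular) diagonal matrices; $F(m,n,p)$ is the set of f-diagonal tensors in $T(m,n,p)$. For $\mathcal{A}\in T(m,n,p)$ and $k=1,\dots,p$ put $\Delta^{(k)}(\mathcal{A})=\sum_{l=1}^p\omega^{(l-1)(k-1)}A^{(l)}\in\mathbb{C}^{m\times n}$, where $\omega=e^{2\pi\sqrt{-1}/p}$, and let $\Delta(\mathcal{A})$ be the block diagonal matrix with diagonal blocks $\Delta^{(1)}(\mathcal{A}),\dots,\Delta^{(p)}(\mathcal{A})$. Saying that $\Delta(\mathcal{A})$ is real and diagonal means that each block $\Delta^{(k)}(\mathcal{A})$ is a real (rectangular) diagonal matrix. Kilmer-Martin mapping $G:T(m,n,p)\to F(m,n,p)$. For $\mathcal{A}\in T(m,n,p)$ let $\mathcal{D}(i,i,k)$, $i=1,\dots,\min\{m,n\}$, be the singular values of $\Delta^{(k)}(\mathcal{A})$ in nonincreasing order (counted with multiplicity). Then $\mathcal{S}=G(\mathcal{A})$ is the f-diagonal tensor with $\mathcal{S}(i,i,k)=\frac1p\sum_{l=1}^p\bar\omega^{(k-1)(l-1)}\mathcal{D}(i,i,l)$ for $i=1,\dots,\min\{m,n\}$, $k=1,\dots,p$ (these numbers are real). A tensor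 $\mathcal{S}\in F(m,n,p)$ is called s-diagonal if there is some $\mathcal{A}\in T(m,n,p)$ with $G(\mathcal{A})=\mathcal{S}$; $S(m,n,p)$ denotes the set of all s-diagonal tensors in $F(m,n,p)$. *)

theory Defs
  imports "Jordan_Normal_Form.Schur_Decomposition" "HOL-Library.Complex_Order"
begin

text \<open>A real tensor of size $m \times n \times p$ is a function on index triples, indexed from 1 and
  undefined outside the index box, so that equality of functions in \<open>tensors m n p\<close> is equality of
  all entries.  Matrices are indexed from 0: entry \<open>(i, j)\<close> of a matrix is the entry
  \<open>(i + 1, j + 1)\<close> in 1-based notation.\<close>

type_synonym tensor = "nat \<times> nat \<times> nat \<Rightarrow> real"

definition tensors :: "nat \<Rightarrow> nat \<Rightarrow> nat \<Rightarrow> tensor set" where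
  "tensors m n p = ({1..m} \<times> {1..n} \<times> {1..p}) \<rightarrow>\<^sub>E UNIV"

definition frontal_slice :: "nat \<Rightarrow> nat \<Rightarrow> tensor \<Rightarrow> nat \<Rightarrow> real mat" where
  "frontal_slice m n A k = mat m n (\<lambda>(i, j). A (i + 1, j + 1, k))"

text \<open>\<open>diagonal_mat\<close> does not require a square matrix.\<close>

definition f_diagonal_tensors :: "nat \<Rightarrow> nat \<Rightarrow> nat \<Rightarrow> tensor set" where
  "f_diagonal_tensors m n p =
    {A \<in> tensors m n p. \<forall>k \<in> {1..p}. diagonal_mat (frontal_slice m n A k)}"

definition omega :: "nat \<Rightarrow> complex" where
  "omega p = exp (2 * of_real pi * \<i> / of_nat p)"

definition Delta :: "nat \<Rightarrow> nat \<Rightarrow> nat \<Rightarrow> tensor \<Rightarrow> nat \<Rightarrow> complex mat" where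
  "Delta m n p A k = mat m n (\<lambda>(i, j).
    \<Sum>l = 1..p. omega p ^ ((l - 1) * (k - 1)) * of_real (frontal_slice m n A l $$ (i, j)))"

text \<open>The singular values of an $m \times n$ matrix $M$ are the $\min\{m,n\}$ largest square roots of
  eigenvalues of $M^* M$, counted with multiplicity.  The roots of the characteristic polynomial of
  $M^* M$ are nonnegative reals, so \<open>Re\<close> loses nothing; if $m < n$, at least $n - m$ of these $n$ roots
  vanish, and \<open>take\<close> drops exactly $n - m$ zeros.\<close>

definition singular_values :: "complex mat \<Rightarrow> real list" where
  "singular_values M = take (min (dim_row M) (dim_col M))
    (rev (sorted_list_of_multiset
      (image_mset (\<lambda>z. sqrt (Re z)) (proots (char_poly (mat_adjoint M * M))))))"

text \<open>In the Kilmer-Martin mapping, the inverse Fourier sum is real because, for $k \ge 2$, the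
  matrices \<open>Delta m n p A k\<close> and \<open>Delta m n p A (p - k + 2)\<close> are complex conjugates of each other and
  so have the same singular values; \<open>Re\<close> only changes the type.\<close>

definition kilmer_martin :: "nat \<Rightarrow> nat \<Rightarrow> nat \<Rightarrow> tensor \<Rightarrow> tensor" where
  "kilmer_martin m n p A = (\<lambda>(i, j, k) \<in> {1..m} \<times> {1..n} \<times> {1..p}.
    if i = j
    then Re (1 / of_nat p * (\<Sum>l = 1..p. cnj (omega p) ^ ((k - 1) * (l - 1)) *
           of_real (singular_values (Delta m n p A l) ! (i - 1))))
    else 0)"

definition s_diagonal_tensors :: "nat \<Rightarrow> nat \<Rightarrow> nat \<Rightarrow> tensor set" where
  "s_diagonal_tensors m n p =
    {S \<in> f_diagonal_tensors m n p. \<exists>A \<in> tensors m n p. kilmer_martin m n p A = S}"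

end

theory Submission
  imports Defs
begin

text \<open>If the inequalities hold, then each \<open>Delta m n p S k\<close> is a diagonal matrix with nonnegative,
  nonincreasing diagonal, so its diagonal is its own list of singular values and Fourier inversion
  gives \<open>kilmer_martin m n p S = S\<close>.  Conversely, the Fourier transform of the real part of an inverse
  Fourier transform has a nonnegative kernel, so it preserves nonnegativity of sequences; it is
  applied to the singular values and to their consecutive differences.  This makes it unnecessary to
  show that conjugate matrices have the same singular values.\<close>

section \<open>Singular values\<close>

lemma mat_adjoint_dim [simp]:
  "dim_row (mat_adjoint M) = dim_col M" "dim_col (mat_adjoint M) = dim_row M"
  by (simp_all add: mat_adjoint_def)

lemma mat_adjoint_index:
  fixes M :: "complex mat"
  assumes "i < dim_col M" "j < dim_row M"
  shows "mat_adjoint M $$ (i, j) = cnj (M $$ (j, i))"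
  using assms by (simp add: mat_adjoint_def mat_of_rows_index)

text \<open>The adjunction for \<open>\<bullet>c\<close>, which conjugates its second argument: both
  sides expand to one double sum over the entries of \<open>M\<close>.\<close>

lemma mat_adjoint_cscalar_prod:
  fixes M :: "complex mat"
  assumes "v \<in> carrier_vec (dim_col M)" "w \<in> carrier_vec (dim_row M)"
  shows "(mat_adjoint M *\<^sub>v w) \<bullet>c v = w \<bullet>c (M *\<^sub>v v)"
proof -
  have "(mat_adjoint M *\<^sub>v w) \<bullet>c v =
      (\<Sum>j<dim_col M. \<Sum>i<dim_row M. cnj (M $$ (i, j)) * w $ i * cnj (v $ j))"
    using assms
    by (simp add: scalar_prod_def mat_adjoint_index sum_distrib_right flip: atLeast0LessThan)
  also have "\<dots> = (\<Sum>i<dim_row M. \<Sum>j<dim_col M. cnj (M $$ (i, j)) * w $ i * cnj (v $ j))"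
    by (rule sum.swap)
  also have "\<dots> = w \<bullet>c (M *\<^sub>v v)"
    using assms
    by (simp add: scalar_prod_def sum_distrib_left sum_distrib_right mult_ac flip: atLeast0LessThan)
  finally show ?thesis .
qed

text \<open>For an eigenvector v, adjunction gives k |v|^2 = |M v|^2, and |v|^2 is positive.\<close>

lemma eigenvalue_adjoint_mult_nonneg:
  fixes M :: "complex mat"
  assumes "eigenvalue (mat_adjoint M * M) k"
  shows "k \<ge> 0"
proof -
  obtain v where v: "v \<in> carrier_vec (dim_col M)" "v \<noteq> 0\<^sub>v (dim_col M)"
    "(mat_adjoint M * M) *\<^sub>v v = k \<cdot>\<^sub>v v"
    using assms by (auto simp: eigenvalue_def eigenvector_def)
  have w: "M *\<^sub>v v \<in> carrier_vec (dim_row M)" by (rule carrier_vecI) simp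
  have "k * (v \<bullet>c v) = ((mat_adjoint M * M) *\<^sub>v v) \<bullet>c v"
    using v by simp
  also have "\<dots> = (mat_adjoint M *\<^sub>v (M *\<^sub>v v)) \<bullet>c v"
    using v by (subst assoc_mult_mat_vec[of _ "dim_col M" "dim_row M" _ "dim_col M"]) auto
  also have "\<dots> = (M *\<^sub>v v) \<bullet>c (M *\<^sub>v v)"
    by (rule mat_adjoint_cscalar_prod[OF v(1) w])
  finally have "k * (v \<bullet>c v) \<ge> 0" by (simp add: conjugate_square_ge_0_vec)
  moreover have "v \<bullet>c v > 0" using conjugate_square_greater_0_vec[OF v(1)] v(2) by simp
  \<comment> \<open>The order on complex numbers compares only numbers with equal imaginary parts,
    so both facts also carry the vanishing of an imaginary part; this forces k to be real.\<close>
  ultimately show ?thesis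
    by (auto simp: less_eq_complex_def less_complex_def zero_le_mult_iff)
qed

lemma adjoint_mult_carrier: "mat_adjoint M * M \<in> carrier_mat (dim_col M) (dim_col M)"
  by auto

text \<open>The characteristic polynomial has degree \<open>dim_col M\<close> and splits over the
  complex numbers, so there are enough roots for \<open>take\<close> to return its full
  count.\<close>

lemma length_singular_values: "length (singular_values M) = min (dim_row M) (dim_col M)"
proof -
  have "size (proots (char_poly (mat_adjoint M * M))) = dim_col M"
    using degree_monic_char_poly[OF adjoint_mult_carrier, of M] by (simp add: size_proots_complex)
  moreover have "length (sorted_list_of_multiset X) = size X" for X :: "real multiset"
    by (simp flip: size_mset)
  ultimately show ?thesis by (simp add: singular_values_def)
qed

lemma singular_values_nonneg:
  assumes "x \<in> set (singular_values M)"
  shows "x \<ge> 0"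
proof -
  let ?P = "char_poly (mat_adjoint M * M)"
  \<comment> \<open>For a nonzero polynomial the elements of \<open>proots\<close> are exactly the
    roots, here the eigenvalues.\<close>
  have "?P \<noteq> 0" using degree_monic_char_poly[OF adjoint_mult_carrier, of M] by auto
  moreover obtain z where "z \<in># proots ?P" "x = sqrt (Re z)"
    using assms unfolding singular_values_def by (auto dest!: in_set_takeD)
  ultimately show ?thesis
    using eigenvalue_adjoint_mult_nonneg[of M z] eigenvalue_root_char_poly[OF adjoint_mult_carrier, of M z]
    by (simp add: less_eq_complex_def)
qed

lemma singular_values_decreasing: "sorted_wrt (\<ge>) (singular_values M)"
  by (simp add: singular_values_def sorted_wrt_take sorted_wrt_rev)

lemma proots_linear_factors:
  fixes xs :: "'a :: idom list"
  shows "proots (\<Prod>x\<leftarrow>xs. [:- x, 1:]) = mset xs"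
proof (induction xs)
  case (Cons x xs)
  have "(\<Prod>x\<leftarrow>xs. [:- x, 1:]) \<noteq> 0" by (auto simp: prod_list_zero_iff)
  then show ?case using Cons by (simp add: proots_mult del: mult_pCons_left)
qed simp

text \<open>For diagonal \<open>M\<close> the product \<open>mat_adjoint M * M\<close> is diagonal
  with entries d^2. Nonnegativity lets the square root return d, and monotonicity makes the sorting
  keep the order of the diagonal.\<close>

lemma singular_values_diagonal:
  assumes M: "M \<in> carrier_mat m n" "diagonal_mat M"
    and entry: "\<And>i. i < min m n \<Longrightarrow> M $$ (i, i) = complex_of_real (d i)"
    and nonneg: "\<And>i. i < min m n \<Longrightarrow> d i \<ge> 0"
    and anti: "\<And>i j. i \<le> j \<Longrightarrow> j < min m n \<Longrightarrow> d j \<le> d i"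
    and i: "i < min m n"
  shows "singular_values M ! i = d i"
proof -
  \<comment> \<open>The product has size n, while d matters only below \<open>min m n\<close>; if m
    < n, the columns of \<open>M\<close> from m on vanish and contribute the padding zeros.\<close>
  define e where "e = (\<lambda>j. if j < m then d j else 0)"
  let ?B = "mat_adjoint M * M"
  have Bc: "?B \<in> carrier_mat n n" using M by auto
  have B: "?B $$ (a, b) = (if a = b then of_real ((e a)\<^sup>2) else 0)" if "a < n" "b < n" for a b
  proof -
    have "?B $$ (a, b) = (\<Sum>r<m. cnj (M $$ (r, a)) * M $$ (r, b))"
      using that M by (simp add: scalar_prod_def mat_adjoint_index atLeast0LessThan)
    \<comment> \<open>Column a has its only possible nonzero entry in row a; if a \<ge> m there is
      no such row, in agreement with \<open>e a = 0\<close>.\<close>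
    also have "\<dots> = (\<Sum>r<m. if r = a then (if a = b then of_real ((e a)\<^sup>2) else 0) else 0)"
      using that M entry by (intro sum.cong) (auto simp: diagonal_mat_def e_def power2_eq_square)
    also have "\<dots> = (if a = b then of_real ((e a)\<^sup>2) else 0)"
      by (auto simp: e_def)
    finally show ?thesis .
  qed
  have "upper_triangular ?B" using Bc B by (auto simp: upper_triangular_def)
  then have "char_poly ?B = (\<Prod>a\<leftarrow>diag_mat ?B. [:- a, 1:])"
    using char_poly_upper_triangular[OF Bc] by simp
  also have "diag_mat ?B = map (\<lambda>j. of_real ((e j)\<^sup>2)) [0..<n]"
    using Bc B by (auto simp: diag_mat_def)
  finally have "proots (char_poly ?B) = mset (map (\<lambda>j. of_real ((e j)\<^sup>2)) [0..<n])"
    by (simp only: proots_linear_factors)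
  moreover have "sqrt (Re (of_real ((e j)\<^sup>2))) = e j" if "j < n" for j
    using nonneg[of j] that by (auto simp: e_def)
  ultimately have "image_mset (\<lambda>z. sqrt (Re z)) (proots (char_poly ?B)) = mset (map e [0..<n])"
    by (auto simp: multiset.map_comp simp flip: mset_map intro!: arg_cong[of _ _ mset])
  \<comment> \<open>The list is nonincreasing, also where the zeros begin since d is nonnegative, so
    sorting reverses it and the \<open>rev\<close> in \<open>singular_values\<close> restores
    it.\<close>
  moreover have "sort (map e [0..<n]) = rev (map e [0..<n])"
  proof (rule properties_for_sort)
    show "sorted (rev (map e [0..<n]))"
      unfolding sorted_wrt_rev
      using anti nonneg by (auto simp: sorted_wrt_iff_nth_less e_def)
  qed simp
  ultimately have "singular_values M = take (min m n) (map e [0..<n])"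
    using M by (simp add: singular_values_def del: mset_map)
  then show ?thesis using i by (simp add: e_def)
qed

section \<open>The discrete Fourier transform\<close>

lemma omega_cis: "omega p = cis (2 * pi / p)"
  by (simp add: omega_def cis_conv_exp mult_ac)

lemma omega_nonzero: "omega p \<noteq> 0"
  by (simp add: omega_def)

lemma omega_pow_p: "p > 0 \<Longrightarrow> omega p ^ p = 1"
  by (simp add: omega_cis DeMoivre)

lemma omega_cnj: "omega p ^ a * cnj (omega p) ^ a = 1"
  by (simp add: omega_cis cis_cnj cis_mult flip: power_mult_distrib)

lemma omega_pow_inj:
  assumes "omega p ^ a = omega p ^ b" "a < p" "b < p"
  shows "a = b"
proof -
  have "inj_on (\<lambda>k. cis (2 * pi * real k / real p)) {..<p}"
    using bij_betw_roots_unity[of p] assms(2) by (simp add: bij_betw_def)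
  moreover have "omega p ^ k = cis (2 * pi * real k / real p)" for k
    by (simp add: omega_cis DeMoivre mult_ac)
  ultimately show ?thesis using assms by (simp add: inj_on_def)
qed

text \<open>A geometric sum: for z \<noteq> 1 its closed form has the factor 1 - z^p, which
  vanishes.\<close>

lemma sum_powers_root_of_unity:
  fixes z :: complex
  assumes "z ^ p = 1"
  shows "(\<Sum>k = 1..p. z ^ (k - 1)) = (if z = 1 then of_nat p else 0)"
proof -
  have "(\<Sum>k = 1..p. z ^ (k - 1)) = (\<Sum>k<p. z ^ k)"
    by (simp add: sum.atLeast1_atMost_eq)
  then show ?thesis using assms by (simp add: sum_gp_strict)
qed

text \<open>The summands are successive powers of one p-th root of unity \<open>?z\<close>, which is
  1 only for j = k because the exponents j - 1 and k - 1 are below p.\<close>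

lemma omega_orthogonality:
  assumes "j \<in> {1..p}" "k \<in> {1..p}"
  shows "(\<Sum>l = 1..p. cnj (omega p) ^ ((k - 1) * (l - 1)) * omega p ^ ((j - 1) * (l - 1)))
    = (if j = k then of_nat p else 0)"
proof -
  let ?z = "cnj (omega p) ^ (k - 1) * omega p ^ (j - 1)"
  have "?z ^ p = (cnj (omega p ^ p)) ^ (k - 1) * (omega p ^ p) ^ (j - 1)"
    by (simp add: power_mult_distrib flip: power_mult) (simp add: mult.commute)
  then have "?z ^ p = 1" using assms by (simp add: omega_pow_p del: complex_cnj_power)
  moreover have "?z = 1 \<longleftrightarrow> j = k"
  proof
    assume "?z = 1"
    \<comment> \<open>Writing 1 as a power of \<open>omega p\<close> times its conjugate exposes a
      common factor to cancel.\<close>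
    then have "cnj (omega p) ^ (k - 1) * omega p ^ (j - 1) =
        cnj (omega p) ^ (k - 1) * omega p ^ (k - 1)"
      using omega_cnj[of p "k - 1"] by (simp only: mult.commute)
    then have "omega p ^ (j - 1) = omega p ^ (k - 1)"
      by (simp add: omega_nonzero)
    then have "j - 1 = k - 1" using omega_pow_inj[of p "j - 1" "k - 1"] assms by auto
    then show "j = k" using assms by auto
  qed (use omega_cnj in \<open>simp add: mult.commute\<close>)
  ultimately show ?thesis
    using sum_powers_root_of_unity[of ?z p] by (simp add: power_mult_distrib power_mult)
qed

text \<open>Exchanging the sums leaves the orthogonality sum as coefficient of each
  \<open>f j\<close>.\<close>

lemma fourier_inversion:
  fixes f :: "nat \<Rightarrow> complex"
  assumes "k \<in> {1..p}"
  shows "1 / of_nat p * (\<Sum>l = 1..p. cnj (omega p) ^ ((k - 1) * (l - 1)) *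
           (\<Sum>j = 1..p. omega p ^ ((j - 1) * (l - 1)) * f j)) = f k"
proof -
  have "(\<Sum>l = 1..p. cnj (omega p) ^ ((k - 1) * (l - 1)) *
           (\<Sum>j = 1..p. omega p ^ ((j - 1) * (l - 1)) * f j))
      = (\<Sum>j = 1..p. (\<Sum>l = 1..p. cnj (omega p) ^ ((k - 1) * (l - 1)) *
           omega p ^ ((j - 1) * (l - 1))) * f j)"
    unfolding sum_distrib_left sum_distrib_right by (subst sum.swap) (simp add: mult.assoc)
  also have "\<dots> = (\<Sum>j = 1..p. if j = k then of_nat p * f j else 0)"
    using assms by (intro sum.cong refl) (simp only: omega_orthogonality, simp)
  also have "\<dots> = of_nat p * f k" using assms by simp
  finally show ?thesis using assms by simp
qed

text \<open>Conjugation exchanges the terms l and p - l + 2, so the sum equals its own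
  conjugate.\<close>

lemma fourier_symmetric_real:
  fixes f :: "nat \<Rightarrow> real"
  assumes "p > 0" and sym: "\<And>l. l \<in> {2..p} \<Longrightarrow> f l = f (p - l + 2)"
  shows "(\<Sum>l = 1..p. omega p ^ ((l - 1) * c) * of_real (f l)) \<in> \<real>" (is "?s \<in> \<real>")
proof -
  let ?g = "\<lambda>l. omega p ^ ((l - 1) * c) * of_real (f l)"
  have cnj_g: "cnj (?g l) = ?g (p - l + 2)" if "l \<in> {2..p}" for l
  proof -
    \<comment> \<open>The offsets of l and of its mirror index p - l + 2 add up to p, so the two
      powers of \<open>omega p\<close> are mutually inverse, hence conjugate.\<close>
    have "(l - 1) * c + (p - l + 1) * c = p * c"
      using that by (subst distrib_right[symmetric]) simp
    then have "omega p ^ ((l - 1) * c) * omega p ^ ((p - l + 1) * c) = (omega p ^ p) ^ c"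
      by (simp only: power_add[symmetric] power_mult[symmetric])
    then have "omega p ^ ((l - 1) * c) * cnj (omega p) ^ ((l - 1) * c) =
        omega p ^ ((l - 1) * c) * omega p ^ ((p - l + 1) * c)"
      by (simp only: omega_cnj omega_pow_p[OF \<open>p > 0\<close>] power_one)
    then have "cnj (omega p) ^ ((l - 1) * c) = omega p ^ ((p - l + 1) * c)"
      by (simp add: omega_nonzero)
    then show ?thesis using sym[OF that] by simp
  qed
  \<comment> \<open>The term l = 1 is split off: its mirror index p + 1 is out of range, but the
    term is real by itself.\<close>
  have s: "?s = of_real (f 1) + (\<Sum>l = 2..p. ?g l)"
    using \<open>p > 0\<close> by (simp add: sum.atLeast_Suc_atMost numeral_2_eq_2)
  have "cnj (\<Sum>l = 2..p. ?g l) = (\<Sum>l = 2..p. ?g (p - l + 2))"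
    unfolding cnj_sum using cnj_g by (rule sum.cong[OF refl])
  also have "\<dots> = (\<Sum>l = 2..p. ?g l)"
    by (rule sum.reindex_bij_witness[of _ "\<lambda>l. p - l + 2" "\<lambda>l. p - l + 2"]) auto
  finally show ?thesis using s by (simp add: Reals_cnj_iff)
qed

text \<open>Splitting the real part as half the sum of a number and its conjugate turns the kernel into the
  mean of two full sums of powers of a \<open>p\<close>-th root of unity, each of which is \<open>p\<close> or \<open>0\<close>.\<close>

lemma fourier_kernel_nonneg:
  assumes "p > 0"
  shows "(\<Sum>k = 1..p. omega p ^ ((k - 1) * a) * of_real (Re (cnj (omega p) ^ ((k - 1) * b)))) \<ge> 0"
proof -
  let ?z = "omega p ^ a * cnj (omega p) ^ b" and ?w = "omega p ^ a * omega p ^ b"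
  have "?w ^ p = (omega p ^ p) ^ a * (omega p ^ p) ^ b"
    by (simp add: power_mult_distrib flip: power_mult) (simp add: mult.commute)
  then have w: "?w ^ p = 1" using assms by (simp add: omega_pow_p)
  have "?z ^ p = (omega p ^ p) ^ a * (cnj (omega p ^ p)) ^ b"
    by (simp add: power_mult_distrib flip: power_mult) (simp add: mult.commute)
  then have z: "?z ^ p = 1" using assms by (simp add: omega_pow_p del: complex_cnj_power)
  have re: "complex_of_real (Re x) = (x + cnj x) / 2" for x
    by (simp add: complex_add_cnj)
  have "(\<Sum>k = 1..p. omega p ^ ((k - 1) * a) * of_real (Re (cnj (omega p) ^ ((k - 1) * b))))
      = (\<Sum>k = 1..p. (?z ^ (k - 1) + ?w ^ (k - 1)) / 2)"
    unfolding re
    by (intro sum.cong refl)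
       (simp add: algebra_simps power_mult_distrib add_divide_distrib flip: power_mult)
  also have "\<dots> = ((\<Sum>k = 1..p. ?z ^ (k - 1)) + (\<Sum>k = 1..p. ?w ^ (k - 1))) / 2"
    by (simp only: sum_divide_distrib[symmetric] sum.distrib)
  also have "\<dots> \<ge> 0"
    unfolding sum_powers_root_of_unity[OF z] sum_powers_root_of_unity[OF w]
    by (simp add: less_eq_complex_def)
  finally show ?thesis .
qed

text \<open>As each \<open>x l\<close> is real, \<open>Re\<close> passes to the powers of
  \<open>cnj (omega p)\<close>. After exchanging the sums, \<open>x l / p\<close> multiplies the
  kernel \<open>?K l\<close>, which is nonnegative.\<close>

lemma fourier_Re_inverse_fourier_nonneg:
  fixes x :: "nat \<Rightarrow> real"
  assumes "p > 0" and x: "\<And>l. l \<in> {1..p} \<Longrightarrow> x l \<ge> 0"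
  shows "(\<Sum>k = 1..p. omega p ^ ((k - 1) * a) * of_real (Re (1 / of_nat p *
    (\<Sum>l = 1..p. cnj (omega p) ^ ((k - 1) * (l - 1)) * of_real (x l))))) \<ge> 0"
proof -
  let ?K = "\<lambda>l. \<Sum>k = 1..p.
    omega p ^ ((k - 1) * a) * of_real (Re (cnj (omega p) ^ ((k - 1) * (l - 1))))"
  have "Re (1 / of_nat p * w) = Re w / p" for w
    by (simp add: Re_divide_of_nat)
  then have "(\<Sum>k = 1..p. omega p ^ ((k - 1) * a) * of_real (Re (1 / of_nat p *
      (\<Sum>l = 1..p. cnj (omega p) ^ ((k - 1) * (l - 1)) * of_real (x l)))))
    = (\<Sum>k = 1..p. \<Sum>l = 1..p. of_real (x l / p) * (omega p ^ ((k - 1) * a) *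
        of_real (Re (cnj (omega p) ^ ((k - 1) * (l - 1))))))"
    by (simp add: sum_distrib_left sum_divide_distrib mult_ac)
  also have "\<dots> = (\<Sum>l = 1..p. of_real (x l / p) * ?K l)"
    by (subst sum.swap) (simp only: sum_distrib_left)
  also have "\<dots> \<ge> 0"
  proof (rule sum_nonneg)
    fix l assume "l \<in> {1..p}"
    then have "complex_of_real (x l / p) \<ge> 0" using x by (simp add: less_eq_complex_def)
    then show "of_real (x l / p) * ?K l \<ge> 0"
      using fourier_kernel_nonneg[OF \<open>p > 0\<close>] by (rule mult_nonneg_nonneg)
  qed
  finally show ?thesis .
qed

section \<open>The Kilmer-Martin mapping\<close>

lemma Delta_carrier [simp]: "Delta m n p A k \<in> carrier_mat m n"
  by (simp add: Delta_def)

lemma Delta_dim [simp]: "dim_row (Delta m n p A k) = m" "dim_col (Delta m n p A k) = n"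
  by (simp_all add: Delta_def)

lemma Delta_diag_entry:
  assumes "i \<in> {1..min m n}"
  shows "Delta m n p A k $$ (i - 1, i - 1) =
    (\<Sum>l = 1..p. omega p ^ ((l - 1) * (k - 1)) * of_real (A (i, i, l)))"
  using assms by (auto simp: Delta_def frontal_slice_def)

lemma f_diagonal_off_diag:
  assumes "A \<in> f_diagonal_tensors m n p"
    and "i \<in> {1..m}" "j \<in> {1..n}" "l \<in> {1..p}" "i \<noteq> j"
  shows "A (i, j, l) = 0"
proof -
  \<comment> \<open>Tensor indices start at 1 and matrix indices at 0, so i and j are shifted
    down.\<close>
  obtain a b where "i = Suc a" "j = Suc b"
    using assms(2,3) by (metis Suc_le_D One_nat_def atLeastAtMost_iff)
  then show ?thesis
    using assms by (auto simp: f_diagonal_tensors_def diagonal_mat_def frontal_slice_def)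
qed

lemma Delta_diagonal:
  assumes "A \<in> f_diagonal_tensors m n p"
  shows "diagonal_mat (Delta m n p A k)"
  using f_diagonal_off_diag[OF assms]
  by (auto simp: Delta_def diagonal_mat_def frontal_slice_def intro!: sum.neutral)

lemma Delta_elements_real:
  assumes "A \<in> f_diagonal_tensors m n p"
    and diag: "\<And>i. i \<in> {1..min m n} \<Longrightarrow> Delta m n p A k $$ (i - 1, i - 1) \<in> \<real>"
  shows "elements_mat (Delta m n p A k) \<subseteq> \<real>"
proof
  fix x assume "x \<in> elements_mat (Delta m n p A k)"
  then obtain i j where ij: "i < m" "j < n" "x = Delta m n p A k $$ (i, j)"
    by (auto simp: elements_mat_def Delta_def)
  show "x \<in> \<real>"
  proof (cases "i = j")
    case True
    then show ?thesis using diag[of "Suc i"] ij by simp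
  next
    case False
    then have "x = 0"
      using Delta_diagonal[OF assms(1), of k] ij
      by (auto simp: diagonal_mat_def)
    then show ?thesis by simp
  qed
qed

lemma kilmer_martin_diag:
  assumes "i \<in> {1..min m n}" "k \<in> {1..p}"
  shows "kilmer_martin m n p A (i, i, k) = Re (1 / of_nat p *
    (\<Sum>l = 1..p. cnj (omega p) ^ ((k - 1) * (l - 1)) *
      of_real (singular_values (Delta m n p A l) ! (i - 1))))"
  using assms by (simp add: kilmer_martin_def)

text \<open>For fixed i, the sequence transformed back and forth is that of the i-th singular values
  of the blocks.\<close>

lemma fourier_kilmer_martin_nonneg:
  assumes "p > 0" "i \<in> {1..min m n}"
  shows "(\<Sum>l = 1..p. omega p ^ ((l - 1) * a) * of_real (kilmer_martin m n p A (i, i, l))) \<ge> 0"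
proof -
  have "singular_values (Delta m n p A l) ! (i - 1) \<ge> 0" for l
    using assms(2)
    by (intro singular_values_nonneg[of _ "Delta m n p A l"] nth_mem) (auto simp: length_singular_values)
  then show ?thesis
    using fourier_Re_inverse_fourier_nonneg[OF \<open>p > 0\<close>] assms(2)
    by (simp add: kilmer_martin_diag)
qed

text \<open>By linearity, the difference of two diagonal tubes comes from the gaps between
  consecutive singular values, which are nonnegative by their ordering.\<close>

lemma fourier_kilmer_martin_diff_nonneg:
  assumes "p > 0" "i \<ge> 1" "i < min m n"
  shows "(\<Sum>l = 1..p. omega p ^ ((l - 1) * a) * of_real
    (kilmer_martin m n p A (i, i, l) - kilmer_martin m n p A (i + 1, i + 1, l))) \<ge> 0"
proof -
  let ?\<sigma> = "\<lambda>i l. singular_values (Delta m n p A l) ! (i - 1)"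
  have "?\<sigma> i l - ?\<sigma> (i + 1) l \<ge> 0" for l
    using assms
      sorted_wrt_nth_less[OF singular_values_decreasing, of "i - 1" i "Delta m n p A l"]
    by (auto simp: length_singular_values)
  from fourier_Re_inverse_fourier_nonneg[OF \<open>p > 0\<close> this, where a = a]
  have "(\<Sum>k = 1..p. omega p ^ ((k - 1) * a) * of_real (Re (1 / of_nat p *
    (\<Sum>l = 1..p. cnj (omega p) ^ ((k - 1) * (l - 1)) * of_real (?\<sigma> i l - ?\<sigma> (i + 1) l))))) \<ge> 0" .
  also have "(\<Sum>k = 1..p. omega p ^ ((k - 1) * a) * of_real (Re (1 / of_nat p *
    (\<Sum>l = 1..p. cnj (omega p) ^ ((k - 1) * (l - 1)) * of_real (?\<sigma> i l - ?\<sigma> (i + 1) l)))))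
    = (\<Sum>k = 1..p. omega p ^ ((k - 1) * a) * of_real
    (kilmer_martin m n p A (i, i, k) - kilmer_martin m n p A (i + 1, i + 1, k)))"
    (is "sum ?f _ = sum ?g _")
  proof (rule sum.cong[OF refl])
    fix k assume "k \<in> {1..p}"
    moreover have "i \<in> {1..min m n}" "i + 1 \<in> {1..min m n}" using assms by auto
    ultimately show "?f k = ?g k"
      by (simp only: kilmer_martin_diag minus_complex.sel[symmetric] right_diff_distrib
          sum_subtractf of_real_diff)
  qed
  finally show ?thesis .
qed

text \<open>This provides \<open>S\<close> itself as the preimage required by
  \<open>s_diagonal_tensors\<close>.\<close>

lemma kilmer_martin_fixed_point:
  assumes S: "S \<in> f_diagonal_tensors m n p"
    and nonneg: "\<And>i k. i \<in> {1..min m n} \<Longrightarrow> k \<in> {1..p} \<Longrightarrow>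
      (\<Sum>l = 1..p. omega p ^ ((l - 1) * (k - 1)) * of_real (S (i, i, l))) \<ge> 0"
    and diff: "\<And>i k. 1 \<le> i \<Longrightarrow> i < min m n \<Longrightarrow> k \<in> {1..p} \<Longrightarrow>
      (\<Sum>l = 1..p. omega p ^ ((l - 1) * (k - 1)) *
        of_real (S (i, i, l) - S (i + 1, i + 1, l))) \<ge> 0"
  shows "kilmer_martin m n p S = S"
proof -
  define s where "s = (\<lambda>i k. \<Sum>l = 1..p. omega p ^ ((l - 1) * (k - 1)) * complex_of_real (S (i, i, l)))"
  \<comment> \<open>In the complex order this includes that \<open>s i k\<close> is real, so taking
    \<open>Re\<close> below changes nothing.\<close>
  have s_pos: "s i k \<ge> 0" if "i \<in> {1..min m n}" "k \<in> {1..p}" for i k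
    using nonneg[OF that] by (simp add: s_def)
  have s_step: "s (i + 1) k \<le> s i k" if "1 \<le> i" "i < min m n" "k \<in> {1..p}" for i k
    using diff[OF that] unfolding s_def of_real_diff right_diff_distrib sum_subtractf
    by (simp only: diff_ge_0_iff_ge)
  \<comment> \<open>The hypotheses compare neighbours only; chaining them compares any two diagonal
    entries.\<close>
  have s_mono: "Re (s j k) \<le> Re (s i k)" if "i \<le> j" "1 \<le> i" "j \<le> min m n" "k \<in> {1..p}" for i j k
    using that(1,3)
  proof (induction j rule: dec_induct)
    case (step q)
    then show ?case using s_step[of q k] that(2,4) by (auto simp: less_eq_complex_def)
  qed simp
  have sv: "of_real (singular_values (Delta m n p S k) ! (i - 1)) = s i k"
    if "i \<in> {1..min m n}" "k \<in> {1..p}" for i k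
  proof -
    \<comment> \<open>The form \<open>Suc (i - 1)\<close> matches the 0-based d of
      \<open>singular_values_diagonal\<close> with the 1-based \<open>s\<close>.\<close>
    have "singular_values (Delta m n p S k) ! (i - 1) = Re (s (Suc (i - 1)) k)"
    proof (rule singular_values_diagonal[of _ m n "\<lambda>i. Re (s (Suc i) k)"])
      fix q assume "q < min m n"
      then have q: "Suc q \<in> {1..min m n}" by auto
      show "0 \<le> Re (s (Suc q) k)"
        using s_pos[OF q that(2)] by (simp add: less_eq_complex_def)
      show "Delta m n p S k $$ (q, q) = of_real (Re (s (Suc q) k))"
      proof -
        have "Delta m n p S k $$ (q, q) = s (Suc q) k"
          using Delta_diag_entry[OF q, of p S k] by (simp add: s_def)
        also have "\<dots> = of_real (Re (s (Suc q) k))"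
          using s_pos[OF q that(2)] by (simp add: less_eq_complex_def complex_eq_iff)
        finally show ?thesis .
      qed
    qed (use that Delta_diagonal[OF S] s_mono in auto)
    then show ?thesis
      using that s_pos[OF that] by (simp add: less_eq_complex_def complex_eq_iff)
  qed
  show ?thesis
  proof
    fix t :: "nat \<times> nat \<times> nat"
    obtain i j k where t: "t = (i, j, k)" by (cases t)
    show "kilmer_martin m n p S t = S t"
    proof (cases "t \<in> {1..m} \<times> {1..n} \<times> {1..p}")
      case False
      \<comment> \<open>Off the index box both sides are \<open>undefined\<close>: \<open>S\<close>
        by extensionality, the image by its restricted lambda.\<close>
      have "S \<in> ({1..m} \<times> {1..n} \<times> {1..p}) \<rightarrow>\<^sub>E UNIV"
        using S by (simp add: f_diagonal_tensors_def tensors_def)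
      then have "S t = undefined" using False by (rule PiE_arb)
      then show ?thesis using False by (simp only: kilmer_martin_def restrict_apply if_False)
    next
      case True
      show ?thesis
      proof (cases "i = j")
        case False
        then show ?thesis
          using True t f_diagonal_off_diag[OF S, of i j k] by (simp add: kilmer_martin_def)
      next
        case [simp]: True
        have i: "i \<in> {1..min m n}" and k: "k \<in> {1..p}"
          using \<open>t \<in> _\<close> t by auto
        have "kilmer_martin m n p S t = Re (1 / of_nat p *
            (\<Sum>l = 1..p. cnj (omega p) ^ ((k - 1) * (l - 1)) * s i l))"
          unfolding t True[symmetric] kilmer_martin_diag[OF i k] using sv[OF i] by simp
        \<comment> \<open>The sum is now the inverse transform of the transform of the tube of
          \<open>S\<close> at (i, i).\<close>
        then show ?thesis
          unfolding s_def fourier_inversion[OF k] by (simp add: t)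
      qed
    qed
  qed
qed

text \<open>The assumption covers the lower half of the range; the reflection k to p - k + 2 carries
  the upper half there.\<close>

lemma third_mode_symmetry_full:
  fixes f :: "nat \<Rightarrow> 'a"
  assumes "\<And>k. k \<in> {2..1 + (p - 1) div 2} \<Longrightarrow> f k = f (p - k + 2)" and "k \<in> {2..p}"
  shows "f k = f (p - k + 2)"
proof (cases "k \<le> 1 + (p - 1) div 2")
  case True
  then show ?thesis using assms by simp
next
  case False
  let ?k = "p - k + 2"
  \<comment> \<open>The first alternative is the fixed point k = p / 2 + 1, which occurs for even
    p.\<close>
  have "?k = k \<or> ?k \<le> 1 + (p - 1) div 2" using False assms(2) by auto
  moreover have "p - ?k + 2 = k" "?k \<ge> 2" using assms(2) by auto
  ultimately show ?thesis using assms(1)[of ?k] by auto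
qed

theorem theorem6p1:
  fixes m n p :: nat and S :: tensor
  assumes "m > 0" and "n > 0" and "p \<ge> 2"
    and "S \<in> f_diagonal_tensors m n p"
    and "\<forall>i \<in> {1..min m n}. \<forall>k \<in> {2..1 + (p - 1) div 2}. S (i, i, k) = S (i, i, p - k + 2)"
  shows "(\<forall>k \<in> {1..p}. elements_mat (Delta m n p S k) \<subseteq> \<real> \<and> diagonal_mat (Delta m n p S k)) \<and>
    (\<forall>i \<in> {1..min m n}. \<forall>k \<in> {1..p}.
      (\<Sum>l = 1..p. omega p ^ ((l - 1) * (k - 1)) * of_real (S (i, i, l)))
        = Delta m n p S k $$ (i - 1, i - 1) \<and>
      Delta m n p S k $$ (i - 1, i - 1) \<in> \<real>) \<and>
    (S \<in> s_diagonal_tensors m n p \<longleftrightarrow>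
      (\<forall>i \<in> {1..min m n}. \<forall>k \<in> {1..p}.
        (\<Sum>l = 1..p. omega p ^ ((l - 1) * (k - 1)) * of_real (S (i, i, l))) \<ge> 0 \<and>
        (\<Sum>l = 1..p. omega p ^ ((l - 1) * (k - 1)) *
          of_real (S (i, i, l) - (if i < min m n then S (i + 1, i + 1, l) else 0))) \<ge> 0))"
    (is "?real \<and> ?entries \<and> (_ \<longleftrightarrow> ?ineq)")
proof (intro conjI)
  have "p > 0" using assms(3) by simp
  have diag_real: "Delta m n p S k $$ (i - 1, i - 1) \<in> \<real>" if "i \<in> {1..min m n}" for i k
    unfolding Delta_diag_entry[OF that]
    using \<open>p > 0\<close> third_mode_symmetry_full[of p "\<lambda>l. S (i, i, l)"] assms(5) that
    by (intro fourier_symmetric_real) blast+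
  show ?real
    using Delta_elements_real[OF assms(4) diag_real] Delta_diagonal[OF assms(4)] by blast
  show ?entries
    using diag_real Delta_diag_entry by simp
  show "S \<in> s_diagonal_tensors m n p \<longleftrightarrow> ?ineq"
  proof
    assume "S \<in> s_diagonal_tensors m n p"
    then obtain A where A: "S = kilmer_martin m n p A"
      by (auto simp: s_diagonal_tensors_def)
    show ?ineq
    proof (intro ballI conjI)
      fix i k assume i: "i \<in> {1..min m n}"
      show pos: "(\<Sum>l = 1..p. omega p ^ ((l - 1) * (k - 1)) * of_real (S (i, i, l))) \<ge> 0"
        unfolding A by (rule fourier_kilmer_martin_nonneg[OF \<open>p > 0\<close> i])
      show "(\<Sum>l = 1..p. omega p ^ ((l - 1) * (k - 1)) *
          of_real (S (i, i, l) - (if i < min m n then S (i + 1, i + 1, l) else 0))) \<ge> 0"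
      proof (cases "i < min m n")
        case True
        then show ?thesis
          using fourier_kilmer_martin_diff_nonneg[OF \<open>p > 0\<close> _ True] i unfolding A by simp
      next
        \<comment> \<open>Here i = \<open>min m n\<close>, the subtracted term is 0, and the claim
          becomes the first inequality.\<close>
        case False
        then show ?thesis using pos by (simp only: if_False diff_zero)
      qed
    qed
  next
    assume ineq: ?ineq
    have "kilmer_martin m n p S = S"
    proof (rule kilmer_martin_fixed_point[OF assms(4)])
      fix i k assume "1 \<le> i" "i < min m n" "k \<in> {1..p}"
      then show "(\<Sum>l = 1..p. omega p ^ ((l - 1) * (k - 1)) *
          of_real (S (i, i, l) - S (i + 1, i + 1, l))) \<ge> 0"
        using bspec[OF bspec[OF ineq, of i], of k] by simp
    qed (use ineq in blast)
    then show "S \<in> s_diagonal_tensors m n p"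
      using assms(4) by (auto simp: s_diagonal_tensors_def f_diagonal_tensors_def)
  qed
qed

end
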